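(* Let $(R,\mathfrak{m})$ be a commutative Noetherian local ring of dimension one and depth zero, and $n$ an integer such that $\mathfrak{m}^n\cap\Gamma_{\mathfrak{m}}(R)=(0)$. Then for any parameter $a$ of $R$ with $a\in\mathfrak{m}^n$ and any parameter $b$ of $R$ with $b\in(a^2)$, the $R/(a)$-module $\operatorname{Hom}_R(R/(a),R/(b))$ is decomposable and has a non-free (direct) summand.
   Context: $\Gamma_{\mathfrak{m}}(R)=\{x\in R : \mathfrak{m}^k x=0 \text{ for some } k\ge 1\}$ is the $\mathfrak{m}$-torsion ideal of $R$. A parameter of a one-dimensional local ring $R$ is an element $a\in\mathfrak{m}$ such that $R/(a)$ has finite length. A module is decomposable if it is the direct sum of two nonzero submodules. Non-free means not free as an $R/(a)$-module. *)

theory Defs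
  imports "HOL-Algebra.Algebra" "HOL-Library.Extended_Nat"
begin

section \<open>Noetherian local rings\<close>

text \<open>
  Powers of an ideal are taken in the library's monoid \<^const>\<open>ideals_set\<close> of ideals under the
  ideal product, so \<open>I [^]\<^bsub>ideals_set R\<^esub> 0\<close> is the whole ring.
\<close>

locale local_ring = maximalideal \<mm> R + R?: cring R for \<mm> and R (structure) +
  assumes maximalideal_unique: "maximalideal M R \<Longrightarrow> M = \<mm>"

text \<open>
  The suprema below are taken in \<^typ>\<open>enat\<close>. A chain \<open>P 0 \<subset> \<dots> \<subset> P n\<close> has length \<open>n\<close>.
\<close>

definition krull_dim :: "('a, 'c) ring_scheme \<Rightarrow> enat" where
  "krull_dim R = (SUP n \<in> {n. \<exists>P :: nat \<Rightarrow> 'a set.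
      (\<forall>i\<le>n. primeideal (P i) R) \<and> (\<forall>i<n. P i \<subset> P (Suc i))}. enat n)"

text \<open>The \<open>i\<close>-th entry is a nonzerodivisor modulo the ideal generated by the previous ones.\<close>

definition regular_seq :: "('a, 'c) ring_scheme \<Rightarrow> 'a list \<Rightarrow> bool" where
  "regular_seq R xs \<longleftrightarrow> set xs \<subseteq> carrier R \<and>
     (\<forall>i<length xs. \<forall>y\<in>carrier R.
        xs ! i \<otimes>\<^bsub>R\<^esub> y \<in> Idl\<^bsub>R\<^esub> (set (take i xs)) \<longrightarrow> y \<in> Idl\<^bsub>R\<^esub> (set (take i xs))) \<and>
     Idl\<^bsub>R\<^esub> (set xs) \<noteq> carrier R"

definition depth :: "('a, 'c) ring_scheme \<Rightarrow> 'a set \<Rightarrow> enat" where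
  "depth R \<mm> = (SUP xs \<in> {xs. set xs \<subseteq> \<mm> \<and> regular_seq R xs}. enat (length xs))"

definition torsion_ideal :: "('a, 'c) ring_scheme \<Rightarrow> 'a set \<Rightarrow> 'a set" where
  "torsion_ideal R \<mm> = {x \<in> carrier R. \<exists>k::nat. k \<ge> 1 \<and>
     (\<forall>y \<in> \<mm> [^]\<^bsub>ideals_set R\<^esub> k. y \<otimes>\<^bsub>R\<^esub> x = \<zero>\<^bsub>R\<^esub>)}"

section \<open>Modules\<close>

definition module_length :: "('a, 'c) ring_scheme \<Rightarrow> ('a, 'b, 'd) module_scheme \<Rightarrow> enat" where
  "module_length R M = (SUP n \<in> {n. \<exists>N :: nat \<Rightarrow> 'b set.
      (\<forall>i\<le>n. submodule (N i) R M) \<and> (\<forall>i<n. N i \<subset> N (Suc i))}. enat n)"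

definition finite_length :: "('a, 'c) ring_scheme \<Rightarrow> ('a, 'b, 'd) module_scheme \<Rightarrow> bool" where
  "finite_length R M \<longleftrightarrow> module_length R M \<noteq> \<infinity>"

definition direct_sum_of ::
  "('a, 'c) ring_scheme \<Rightarrow> ('a, 'b, 'd) module_scheme \<Rightarrow> 'b set \<Rightarrow> 'b set \<Rightarrow> bool" where
  "direct_sum_of R M N N' \<longleftrightarrow> submodule N R M \<and> submodule N' R M \<and>
     N \<inter> N' = {\<zero>\<^bsub>M\<^esub>} \<and> N <+>\<^bsub>M\<^esub> N' = carrier M"

definition direct_summand ::
  "('a, 'c) ring_scheme \<Rightarrow> ('a, 'b, 'd) module_scheme \<Rightarrow> 'b set \<Rightarrow> bool" where
  "direct_summand R M N \<longleftrightarrow> (\<exists>N'. direct_sum_of R M N N')"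

definition decomposable :: "('a, 'c) ring_scheme \<Rightarrow> ('a, 'b, 'd) module_scheme \<Rightarrow> bool" where
  "decomposable R M \<longleftrightarrow>
     (\<exists>N N'. direct_sum_of R M N N' \<and> N \<noteq> {\<zero>\<^bsub>M\<^esub>} \<and> N' \<noteq> {\<zero>\<^bsub>M\<^esub>})"

definition is_basis ::
  "('a, 'c) ring_scheme \<Rightarrow> ('a, 'b, 'd) module_scheme \<Rightarrow> 'b set \<Rightarrow> bool" where
  "is_basis R M B \<longleftrightarrow> B \<subseteq> carrier M \<and>
     (\<forall>x\<in>carrier M. \<exists>A c. finite A \<and> A \<subseteq> B \<and> c \<in> A \<rightarrow> carrier R \<and>
        x = (\<Oplus>\<^bsub>M\<^esub>v\<in>A. c v \<odot>\<^bsub>M\<^esub> v)) \<and>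
     (\<forall>A c. finite A \<longrightarrow> A \<subseteq> B \<longrightarrow> c \<in> A \<rightarrow> carrier R \<longrightarrow>
        (\<Oplus>\<^bsub>M\<^esub>v\<in>A. c v \<odot>\<^bsub>M\<^esub> v) = \<zero>\<^bsub>M\<^esub> \<longrightarrow> (\<forall>v\<in>A. c v = \<zero>\<^bsub>R\<^esub>))"

text \<open>The basis may be infinite, and the zero module is free on the empty basis.\<close>

definition free_module :: "('a, 'c) ring_scheme \<Rightarrow> ('a, 'b, 'd) module_scheme \<Rightarrow> bool" where
  "free_module R M \<longleftrightarrow> (\<exists>B. is_basis R M B)"

section \<open>Quotients and homomorphism modules\<close>

text \<open>\<open>R/I\<close> as an \<open>R\<close>-module: the quotient ring with \<open>r \<cdot> x = (r + I) x\<close>.\<close>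

definition quot_module :: "('a, 'c) ring_scheme \<Rightarrow> 'a set \<Rightarrow> ('a, 'a set) module" where
  "quot_module R I = ring.extend (R Quot I)
     (module.fields (\<lambda>r x. (I +>\<^bsub>R\<^esub> r) \<otimes>\<^bsub>R Quot I\<^esub> x))"

definition parameter :: "('a, 'c) ring_scheme \<Rightarrow> 'a set \<Rightarrow> 'a \<Rightarrow> bool" where
  "parameter R \<mm> a \<longleftrightarrow> a \<in> \<mm> \<and> finite_length R (quot_module R (PIdl\<^bsub>R\<^esub> a))"

text \<open>
  Homomorphisms are extensional functions, so that each one is represented by exactly one
  HOL function.
\<close>

definition module_homs ::
  "('a, 'c) ring_scheme \<Rightarrow> ('a, 'b, 'd) module_scheme \<Rightarrow> ('a, 'e, 'f) module_scheme
    \<Rightarrow> ('b \<Rightarrow> 'e) set" where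
  "module_homs R M N = {f \<in> carrier M \<rightarrow>\<^sub>E carrier N.
     (\<forall>x\<in>carrier M. \<forall>y\<in>carrier M. f (x \<oplus>\<^bsub>M\<^esub> y) = f x \<oplus>\<^bsub>N\<^esub> f y) \<and>
     (\<forall>r\<in>carrier R. \<forall>x\<in>carrier M. f (r \<odot>\<^bsub>M\<^esub> x) = r \<odot>\<^bsub>N\<^esub> f x)}"

text \<open>
  \<open>Hom\<^sub>R(R/I, N)\<close> as an \<open>R/I\<close>-module, with the action \<open>(s \<cdot> f)(x) = f(s x)\<close> coming from the first
  argument; \<open>(r + I) \<cdot> f = r \<cdot> f\<close>, see \<open>hom_quot_module_smult\<close> below.
  The fields \<^const>\<open>monoid.mult\<close> and \<^const>\<open>monoid.one\<close> of a module record carry no meaning.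
\<close>

definition hom_quot_module ::
  "('a, 'c) ring_scheme \<Rightarrow> 'a set \<Rightarrow> ('a, 'e, 'f) module_scheme
    \<Rightarrow> ('a set, 'a set \<Rightarrow> 'e) module" where
  "hom_quot_module R I N =
     \<lparr>carrier = module_homs R (quot_module R I) N,
      monoid.mult = undefined,
      monoid.one = undefined,
      ring.zero = (\<lambda>x\<in>carrier (R Quot I). \<zero>\<^bsub>N\<^esub>),
      ring.add = (\<lambda>f g. \<lambda>x\<in>carrier (R Quot I). f x \<oplus>\<^bsub>N\<^esub> g x),
      smult = (\<lambda>s f. \<lambda>x\<in>carrier (R Quot I). f (s \<otimes>\<^bsub>R Quot I\<^esub> x))\<rparr>"

lemma quot_module_simps [simp]:
  "carrier (quot_module R I) = carrier (R Quot I)"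
  "ring.add (quot_module R I) = ring.add (R Quot I)"
  "ring.zero (quot_module R I) = ring.zero (R Quot I)"
  "smult (quot_module R I) = (\<lambda>r x. (I +>\<^bsub>R\<^esub> r) \<otimes>\<^bsub>R Quot I\<^esub> x)"
  by (simp_all add: quot_module_def ring.defs module.defs)

lemma hom_quot_module_simps [simp]:
  "carrier (hom_quot_module R I N) = module_homs R (quot_module R I) N"
  "ring.zero (hom_quot_module R I N) = (\<lambda>x\<in>carrier (R Quot I). \<zero>\<^bsub>N\<^esub>)"
  "ring.add (hom_quot_module R I N) = (\<lambda>f g. \<lambda>x\<in>carrier (R Quot I). f x \<oplus>\<^bsub>N\<^esub> g x)"
  "smult (hom_quot_module R I N) =
     (\<lambda>s f. \<lambda>x\<in>carrier (R Quot I). f (s \<otimes>\<^bsub>R Quot I\<^esub> x))"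
  by (simp_all add: hom_quot_module_def)

lemma module_quot_module:
  assumes "cring R" "ideal I R"
  shows "module R (quot_module R I)"
proof -
  interpret R: cring R by fact
  interpret I: ideal I R by fact
  interpret Q: cring "R Quot I" by (rule I.quotient_is_cring[OF assms(1)])
  interpret h: ring_hom_ring R "R Quot I" "(+>\<^bsub>R\<^esub>) I" by (rule I.rcos_ring_hom_ring)
  have "abelian_group (quot_module R I)"
    by (rule abelian_groupI)
      (auto simp: Q.add.m_ac intro!: bexI[of _ "\<ominus>\<^bsub>R Quot I\<^esub> _"] Q.l_neg)
  moreover have "I +>\<^bsub>R\<^esub> r \<in> carrier (R Quot I)" if "r \<in> carrier R" for r
    using that by (rule h.hom_closed)
  ultimately show ?thesis
    by (intro moduleI assms) (simp_all add: Q.l_distr Q.r_distr Q.m_assoc)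
qed

lemma hom_quot_module_smult:
  assumes "f \<in> carrier (hom_quot_module R I N)" "r \<in> carrier R"
  shows "(I +>\<^bsub>R\<^esub> r) \<odot>\<^bsub>hom_quot_module R I N\<^esub> f = (\<lambda>x\<in>carrier (R Quot I). r \<odot>\<^bsub>N\<^esub> f x)"
  using assms by (auto simp: module_homs_def fun_eq_iff)

lemma module_hom_quot_module:
  assumes "cring R" "ideal I R" "module R N"
  shows "module (R Quot I) (hom_quot_module R I N)"
proof -
  interpret R: cring R by fact
  interpret I: ideal I R by fact
  interpret Q: cring "R Quot I" by (rule I.quotient_is_cring[OF assms(1)])
  interpret h: ring_hom_ring R "R Quot I" "(+>\<^bsub>R\<^esub>) I" by (rule I.rcos_ring_hom_ring)
  interpret N: module R N by fact
  let ?H = "hom_quot_module R I N"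
  let ?C = "carrier (R Quot I)"
  have homI: "f \<in> carrier ?H" if "f \<in> ?C \<rightarrow>\<^sub>E carrier N"
    "\<And>x y. x \<in> ?C \<Longrightarrow> y \<in> ?C \<Longrightarrow> f (x \<oplus>\<^bsub>R Quot I\<^esub> y) = f x \<oplus>\<^bsub>N\<^esub> f y"
    "\<And>r x. r \<in> carrier R \<Longrightarrow> x \<in> ?C \<Longrightarrow> f ((I +>\<^bsub>R\<^esub> r) \<otimes>\<^bsub>R Quot I\<^esub> x) = r \<odot>\<^bsub>N\<^esub> f x" for f
    using that by (auto simp: module_homs_def)
  have hom_ext: "f \<in> extensional ?C" and hom_closed: "\<And>x. x \<in> ?C \<Longrightarrow> f x \<in> carrier N"
    and hom_add: "\<And>x y. x \<in> ?C \<Longrightarrow> y \<in> ?C \<Longrightarrow> f (x \<oplus>\<^bsub>R Quot I\<^esub> y) = f x \<oplus>\<^bsub>N\<^esub> f y"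
    and hom_smult: "\<And>r x. r \<in> carrier R \<Longrightarrow> x \<in> ?C \<Longrightarrow>
        f ((I +>\<^bsub>R\<^esub> r) \<otimes>\<^bsub>R Quot I\<^esub> x) = r \<odot>\<^bsub>N\<^esub> f x"
    if "f \<in> carrier ?H" for f
    using that by (auto simp: module_homs_def PiE_iff)
  have hC: "I +>\<^bsub>R\<^esub> r \<in> ?C" if "r \<in> carrier R" for r
    using that by (rule h.hom_closed)
  have add_closed: "f \<oplus>\<^bsub>?H\<^esub> g \<in> carrier ?H" if "f \<in> carrier ?H" "g \<in> carrier ?H" for f g
    by (rule homI)
      (auto simp: hom_closed[OF that(1)] hom_closed[OF that(2)] hom_add[OF that(1)] hom_add[OF that(2)]
        hom_smult[OF that(1)] hom_smult[OF that(2)] N.M.add.m_ac N.smult_r_distr hC)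
  have zero_closed: "\<zero>\<^bsub>?H\<^esub> \<in> carrier ?H"
    by (rule homI) (auto simp: hC)
  have neg: "\<exists>g\<in>carrier ?H. g \<oplus>\<^bsub>?H\<^esub> f = \<zero>\<^bsub>?H\<^esub>" if f: "f \<in> carrier ?H" for f
  proof
    show "(\<lambda>x\<in>?C. \<ominus>\<^bsub>N\<^esub> f x) \<in> carrier ?H"
      by (rule homI)
        (auto simp: hom_closed[OF f] hom_add[OF f] hom_smult[OF f] hC N.M.minus_add N.smult_r_minus)
    show "(\<lambda>x\<in>?C. \<ominus>\<^bsub>N\<^esub> f x) \<oplus>\<^bsub>?H\<^esub> f = \<zero>\<^bsub>?H\<^esub>"
      by (auto simp: fun_eq_iff hom_closed[OF f] N.M.l_neg)
  qed
  have grp: "abelian_group ?H"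
  proof (rule abelian_groupI)
    show "\<zero>\<^bsub>?H\<^esub> \<oplus>\<^bsub>?H\<^esub> f = f" if "f \<in> carrier ?H" for f
      using hom_ext[OF that] hom_closed[OF that]
      by (intro extensionalityI[of _ ?C]) auto
  qed (use add_closed zero_closed neg hom_closed in
      \<open>auto simp: fun_eq_iff N.M.add.m_ac simp del: hom_quot_module_simps(1)\<close>)
  have smult_closed: "s \<odot>\<^bsub>?H\<^esub> f \<in> carrier ?H" if s: "s \<in> ?C" and f: "f \<in> carrier ?H" for s f
  proof (rule homI)
    show "s \<odot>\<^bsub>?H\<^esub> f \<in> ?C \<rightarrow>\<^sub>E carrier N"
      using s hom_closed[OF f] by auto
    show "(s \<odot>\<^bsub>?H\<^esub> f) (x \<oplus>\<^bsub>R Quot I\<^esub> y) = (s \<odot>\<^bsub>?H\<^esub> f) x \<oplus>\<^bsub>N\<^esub> (s \<odot>\<^bsub>?H\<^esub> f) y"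
      if "x \<in> ?C" "y \<in> ?C" for x y
      using that s by (simp add: hom_add[OF f] Q.r_distr)
    show "(s \<odot>\<^bsub>?H\<^esub> f) ((I +>\<^bsub>R\<^esub> r) \<otimes>\<^bsub>R Quot I\<^esub> x) = r \<odot>\<^bsub>N\<^esub> (s \<odot>\<^bsub>?H\<^esub> f) x"
      if "r \<in> carrier R" "x \<in> ?C" for r x
      using that s hC by (simp add: hom_smult[OF f, symmetric] Q.m_lcomm)
  qed
  show ?thesis
  proof (rule moduleI[OF Q.is_cring grp])
    show "\<one>\<^bsub>R Quot I\<^esub> \<odot>\<^bsub>?H\<^esub> f = f" if "f \<in> carrier ?H" for f
      using hom_ext[OF that] by (intro extensionalityI[of _ ?C]) auto
    show "(s \<otimes>\<^bsub>R Quot I\<^esub> t) \<odot>\<^bsub>?H\<^esub> f = s \<odot>\<^bsub>?H\<^esub> (t \<odot>\<^bsub>?H\<^esub> f)"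
      if "s \<in> ?C" "t \<in> ?C" "f \<in> carrier ?H" for s t f
      using that by (auto simp: fun_eq_iff Q.m_ac)
    show "(s \<oplus>\<^bsub>R Quot I\<^esub> t) \<odot>\<^bsub>?H\<^esub> f = s \<odot>\<^bsub>?H\<^esub> f \<oplus>\<^bsub>?H\<^esub> t \<odot>\<^bsub>?H\<^esub> f"
      if "s \<in> ?C" "t \<in> ?C" "f \<in> carrier ?H" for s t f
      using that by (auto simp: fun_eq_iff Q.l_distr hom_add simp del: hom_quot_module_simps(1))
  qed (use smult_closed in \<open>auto simp: fun_eq_iff simp del: hom_quot_module_simps(1)\<close>)
qed

end

theory Submission
  imports Defs
begin

text \<open>
  Put \<open>I = (a)\<close>, \<open>J = (b)\<close> and let \<open>Z\<close> be the ideal of all \<open>x\<close> with \<open>a x = 0\<close>. Since \<open>b\<close> is a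
  multiple of \<open>a\<^sup>2\<close>, it is \<open>c a\<close> for some \<open>c \<in> (a)\<close>. A homomorphism \<open>R/I \<rightarrow> R/J\<close> is determined by
  the image of \<open>1\<close>, which can be the class of \<open>z\<close> exactly if \<open>a z \<in> (c a)\<close>, that is, if
  \<open>a (z - r c) = 0\<close> for some \<open>r\<close>. So the module of homomorphisms is \<open>(Z + (c))/(b)\<close>
  (\<open>carrier_Hom\<close>, \<open>colon_principal\<close>).

  The sum is direct because \<open>Z \<inter> (a) = 0\<close>: some power of \<open>\<mm>\<close> lies in \<open>(a)\<close>, as \<open>R/(a)\<close> has finite
  length (\<open>pow_subset_if_finite_length\<close>), so \<open>Z\<close> consists of torsion elements, whereas \<open>(a)\<close> lies in
  \<open>\<mm>\<^sup>n\<close>, which contains no torsion but \<open>0\<close>. Hence the module is the direct sum of (a copy of) \<open>Z\<close> and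
  \<open>(c)/(b)\<close>. In depth zero \<open>a\<close> is a zero divisor, so \<open>Z \<noteq> 0\<close>. If \<open>c\<close> were in \<open>(b) = (c a)\<close>, then
  \<open>c (1 - s a) = 0\<close> for some \<open>s\<close>, so \<open>c = 0\<close> and \<open>b = 0\<close>; but \<open>0\<close> is not a parameter in dimension one,
  since then \<open>\<mm>\<close> would be nilpotent.

  The summand \<open>Z\<close> is not free over \<open>R/(a)\<close> (\<open>annihilator_elem_not_faithful\<close>): a basis vector would
  be a \<open>g \<in> Z\<close> such that \<open>r g = 0\<close> only for \<open>r \<in> (a)\<close>. It is not a unit, because \<open>a g = 0 \<noteq> a\<close>, so
  some power of \<open>g\<close> lies in \<open>(a)\<close>. But if \<open>g\<^sup>j\<^sup>+\<^sup>1\<close> lies in \<open>(a)\<close>, it also lies in \<open>Z\<close>, so it is \<open>0\<close>, and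
  then \<open>g\<^sup>j\<close> annihilates \<open>g\<close> and hence lies in \<open>(a)\<close>. Descending, \<open>1 \<in> (a)\<close>, which is absurd.
\<close>

section \<open>Units of a local ring\<close>

lemma (in cring) proper_ideal_in_maximalideal:
  assumes J: "ideal J R" and proper: "J \<noteq> carrier R"
  obtains M where "maximalideal M R" "J \<subseteq> M"
proof -
  define A where "A = {M. ideal M R \<and> J \<subseteq> M \<and> \<one> \<notin> M}"
  have one: "\<one> \<notin> J"
    using J proper ideal.one_imp_carrier by blast
  have "\<exists>M\<in>A. \<forall>K\<in>A. M \<subseteq> K \<longrightarrow> K = M"
  proof (rule subset_Zorn_nonempty)
    show "A \<noteq> {}"
      using J one unfolding A_def by blast
  next
    fix C assume C: "C \<noteq> {}" "subset.chain A C"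
    have "subset.chain {I. ideal I R} C"
      using C unfolding A_def pred_on.chain_def by blast
    then have "ideal (\<Union>C) R"
      using chain_Union_is_ideal[of C] C(1) by simp
    then show "\<Union>C \<in> A"
      using C unfolding A_def pred_on.chain_def by blast
  qed
  then obtain M where M: "M \<in> A" "\<And>K. K \<in> A \<Longrightarrow> M \<subseteq> K \<Longrightarrow> K = M"
    by blast
  have "maximalideal M R"
  proof (rule maximalidealI)
    show "ideal M R" "carrier R \<noteq> M"
      using M(1) unfolding A_def by auto
  next
    fix K assume K: "ideal K R" "M \<subseteq> K"
    then show "K = M \<or> K = carrier R"
      using M ideal.one_imp_carrier[OF K(1)] unfolding A_def by blast
  qed
  then show ?thesis
    using that M(1) unfolding A_def by blast
qed

lemma (in local_ring) Units_if_notin_max: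
  assumes x: "x \<in> carrier R" "x \<notin> \<mm>"
  shows "x \<in> Units R"
proof -
  have "PIdl x = carrier R"
  proof (rule ccontr)
    assume "PIdl x \<noteq> carrier R"
    then obtain M where "maximalideal M R" "PIdl x \<subseteq> M"
      using proper_ideal_in_maximalideal[OF cgenideal_ideal[OF x(1)]] by blast
    then show False
      using maximalideal_unique cgenideal_self[OF x(1)] x(2) by blast
  qed
  then have "\<one> \<in> PIdl x"
    by simp
  then obtain u where u: "u \<in> carrier R" "u \<otimes> x = \<one>"
    unfolding cgenideal_def by auto
  then have "x \<otimes> u = \<one>"
    using x(1) m_comm by simp
  then show ?thesis
    using u x(1) unfolding Units_def by blast
qed

text \<open>
  Nakayama's lemma for the cyclic module \<open>(x) + K / K\<close>: the factor \<open>1 - r y\<close> of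
  \<open>x - r x y\<close> is a unit.
\<close>

lemma (in local_ring) mem_ideal_if_mult_max_diff:
  assumes K: "ideal K R" and x: "x \<in> carrier R" and y: "y \<in> \<mm>" and r: "r \<in> carrier R"
    and diff: "x \<ominus> r \<otimes> (x \<otimes> y) \<in> K"
  shows "x \<in> K"
proof -
  interpret K: ideal K R by fact
  have y': "y \<in> carrier R" using y a_subset by blast
  let ?u = "\<one> \<ominus> r \<otimes> y"
  have u: "?u \<in> carrier R" using r y' by simp
  have ry: "r \<otimes> y \<in> \<mm>" using r y I_l_closed by blast
  have "?u \<notin> \<mm>"
  proof
    assume "?u \<in> \<mm>"
    then have "?u \<oplus> r \<otimes> y \<in> \<mm>" using ry by blast
    moreover have "?u \<oplus> r \<otimes> y = \<one>" using r y' by algebra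
    ultimately show False
      using one_imp_carrier I_notcarr by simp
  qed
  then obtain v where v: "v \<in> carrier R" "v \<otimes> ?u = \<one>"
    using Units_if_notin_max[OF u] unfolding Units_def by blast
  have "x \<ominus> r \<otimes> (x \<otimes> y) = ?u \<otimes> x" using x r y' by algebra
  then have "v \<otimes> (?u \<otimes> x) \<in> K" using diff v(1) K.I_l_closed by simp
  moreover have "v \<otimes> (?u \<otimes> x) = x"
    using v u x by (metis l_one m_assoc)
  ultimately show ?thesis by simp
qed

section \<open>Powers of the maximal ideal and finite length\<close>

lemma (in cring) ideals_set_pow_0: "I [^]\<^bsub>ideals_set R\<^esub> (0::nat) = carrier R"
  unfolding nat_pow_def ideals_set_def by simp

lemma (in cring) ideals_set_pow_Suc:
  "I [^]\<^bsub>ideals_set R\<^esub> (Suc k) = ideal_prod R (I [^]\<^bsub>ideals_set R\<^esub> k) I"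
proof -
  interpret M: comm_monoid "ideals_set R" by (rule ideals_set_is_comm_monoid)
  have "I [^]\<^bsub>ideals_set R\<^esub> (Suc k) = (I [^]\<^bsub>ideals_set R\<^esub> k) \<otimes>\<^bsub>ideals_set R\<^esub> I"
    by (rule M.nat_pow_Suc)
  then show ?thesis
    by (simp only: ideals_set_def monoid.simps)
qed

lemma (in cring) ideal_ideals_set_pow:
  assumes "ideal I R"
  shows "ideal (I [^]\<^bsub>ideals_set R\<^esub> (k::nat)) R"
proof (induction k)
  case (Suc k)
  then show ?case
    by (simp only: ideals_set_pow_Suc) (rule ideal_prod_is_ideal[OF _ assms])
qed (simp only: ideals_set_pow_0 oneideal)

lemma (in cring) pow_mem_ideals_set_pow:
  assumes "ideal I R" "x \<in> I"
  shows "x [^] (k::nat) \<in> I [^]\<^bsub>ideals_set R\<^esub> k"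
proof (induction k)
  case (Suc k)
  then show ?case
    unfolding ideals_set_pow_Suc nat_pow_Suc by (rule ideal_prod.prod) (rule assms)
qed (simp only: ideals_set_pow_0 nat_pow_0 one_closed)

lemma (in cring) submodule_principal_quot_module:
  assumes I: "ideal I R" and p: "p \<in> carrier R"
  shows "submodule ((\<lambda>r. I +> (r \<otimes> p)) ` carrier R) R (quot_module R I)"
proof -
  interpret I: ideal I R by fact
  interpret h: ring_hom_ring R "R Quot I" "(+>) I" by (rule I.rcos_ring_hom_ring)
  interpret M: module R "quot_module R I" by (rule module_quot_module[OF is_cring I])
  let ?N = "(\<lambda>r. I +> (r \<otimes> p)) ` carrier R"
  have smult: "r \<odot>\<^bsub>quot_module R I\<^esub> x \<in> ?N" if r: "r \<in> carrier R" and x: "x \<in> ?N" for r x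
  proof -
    obtain s where s: "s \<in> carrier R" "x = I +> (s \<otimes> p)" using x by blast
    have "r \<odot>\<^bsub>quot_module R I\<^esub> x = I +> ((r \<otimes> s) \<otimes> p)"
      using r s p by (simp add: m_assoc)
    then show ?thesis using r s by blast
  qed
  show ?thesis
  proof (rule M.submoduleI)
    show sub: "?N \<subseteq> carrier (quot_module R I)" using p by auto
    show "\<zero>\<^bsub>quot_module R I\<^esub> \<in> ?N"
      using p h.hom_zero by (intro image_eqI[of _ _ \<zero>]) auto
    show "\<ominus>\<^bsub>quot_module R I\<^esub> x \<in> ?N" if x: "x \<in> ?N" for x
    proof -
      have xc: "x \<in> carrier (quot_module R I)" using x sub by blast
      have "\<ominus>\<^bsub>quot_module R I\<^esub> x = (\<ominus> \<one>) \<odot>\<^bsub>quot_module R I\<^esub> x"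
        using M.smult_l_minus[OF one_closed xc] M.smult_one[OF xc] by simp
      then show ?thesis using smult[of "\<ominus> \<one>" x] x by simp
    qed
    show "x \<oplus>\<^bsub>quot_module R I\<^esub> y \<in> ?N" if xy: "x \<in> ?N" "y \<in> ?N" for x y
    proof -
      obtain s t where st: "s \<in> carrier R" "x = I +> (s \<otimes> p)" "t \<in> carrier R" "y = I +> (t \<otimes> p)"
        using xy by blast
      have "x \<oplus>\<^bsub>quot_module R I\<^esub> y = I +> ((s \<oplus> t) \<otimes> p)"
        using st p by (simp add: l_distr)
      then show ?thesis using st by blast
    qed
  qed (use smult in blast)
qed

text \<open>
  If \<open>p u\<^sub>1 \<cdots> u\<^sub>j\<close> lies outside \<open>I\<close> for some \<open>u\<^sub>i \<in> \<mm>\<close>, then in \<open>R/I\<close> each of the cyclic submodules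
  \<open>(p) \<supseteq> (p u\<^sub>1) \<supseteq> \<dots> \<supseteq> (p u\<^sub>1 \<cdots> u\<^sub>j)\<close> is strictly larger than the next one, by Nakayama's lemma.
  The last clause of the conclusion, which names the top of the chain, is what allows the
  induction to add one more submodule.
\<close>

lemma (in local_ring) chain_if_mult_pow_notin:
  assumes I: "ideal I R" and p: "p \<in> carrier R"
    and y: "y \<in> \<mm> [^]\<^bsub>ideals_set R\<^esub> j" and py: "p \<otimes> y \<notin> I"
  shows "\<exists>N. (\<forall>i\<le>j. submodule (N i) R (quot_module R I)) \<and> (\<forall>i<j. N i \<subset> N (Suc i)) \<and>
    N j = (\<lambda>r. I +> (r \<otimes> p)) ` carrier R"
  using p y py
proof (induction j arbitrary: p y)
  case 0
  then show ?case
    by (intro exI[of _ "\<lambda>_. (\<lambda>r. I +> (r \<otimes> p)) ` carrier R"])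
      (auto intro: submodule_principal_quot_module[OF I])
next
  case (Suc j)
  interpret I: ideal I R by fact
  note p = \<open>p \<in> carrier R\<close>
  have pow_carrier: "v \<in> carrier R" if "v \<in> \<mm> [^]\<^bsub>ideals_set R\<^esub> k" for v and k :: nat
    using ideal.Icarr[OF ideal_ideals_set_pow[OF is_ideal] that] .
  \<comment> \<open>The products \<open>v u\<close> only generate \<open>\<mm>\<^sup>j\<^sup>+\<^sup>1\<close> additively, but the ideal \<open>I\<close> is closed under sums,
    so \<open>p\<close> times one of these generators is outside \<open>I\<close>.\<close>
  have "\<exists>u\<in>\<mm>. \<exists>v\<in>\<mm> [^]\<^bsub>ideals_set R\<^esub> j. (p \<otimes> u) \<otimes> v \<notin> I"
  proof (rule ccontr)
    assume *: "\<not> ?thesis"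
    have "w \<in> carrier R \<and> p \<otimes> w \<in> I" if "w \<in> ideal_prod R (\<mm> [^]\<^bsub>ideals_set R\<^esub> j) \<mm>" for w
      using that
    proof induction
      case (prod v u)
      then have "v \<in> carrier R" "u \<in> carrier R"
        using pow_carrier Icarr by auto
      moreover have "(p \<otimes> u) \<otimes> v \<in> I"
        using * prod by blast
      ultimately show ?case
        using p by (simp add: m_ac)
    next
      case (sum s1 s2)
      then show ?case
        using p by (simp add: r_distr I.a_closed)
    qed
    then show False
      using Suc.prems unfolding ideals_set_pow_Suc by blast
  qed
  then obtain u v where u: "u \<in> \<mm>" and v: "v \<in> \<mm> [^]\<^bsub>ideals_set R\<^esub> j" and "(p \<otimes> u) \<otimes> v \<notin> I"
    by blast
  moreover have u': "u \<in> carrier R" using u Icarr by blast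
  ultimately obtain N where N: "\<forall>i\<le>j. submodule (N i) R (quot_module R I)"
    "\<forall>i<j. N i \<subset> N (Suc i)" "N j = (\<lambda>r. I +> (r \<otimes> (p \<otimes> u))) ` carrier R"
    using Suc.IH[of "p \<otimes> u" v] p by auto
  let ?P = "(\<lambda>r. I +> (r \<otimes> p)) ` carrier R"
  have "N j \<subseteq> ?P"
  proof
    fix x assume "x \<in> N j"
    then obtain r where "r \<in> carrier R" "x = I +> (r \<otimes> (p \<otimes> u))" using N(3) by blast
    then show "x \<in> ?P"
      using p u' by (intro image_eqI[of _ _ "r \<otimes> u"]) (simp_all add: m_ac)
  qed
  moreover have "I +> p \<in> ?P"
    using p by (intro image_eqI[of _ _ \<one>]) simp_all
  moreover have "I +> p \<notin> N j"
  proof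
    assume "I +> p \<in> N j"
    then obtain r where r: "r \<in> carrier R" "I +> p = I +> (r \<otimes> (p \<otimes> u))"
      using N(3) by blast
    then have "p \<ominus> r \<otimes> (p \<otimes> u) \<in> I"
      using quotient_eq_iff_same_a_r_cos[OF I p] p u' by simp
    then have "p \<in> I"
      using mem_ideal_if_mult_max_diff[OF I p u r(1)] by blast
    then have "p \<otimes> y \<in> I"
      using I.I_r_closed pow_carrier Suc.prems(2) by blast
    then show False
      using Suc.prems(3) by blast
  qed
  ultimately have psub: "N j \<subset> ?P" by blast
  show ?case
  proof (intro exI[of _ "N(Suc j := ?P)"] conjI allI impI)
    show "submodule ((N(Suc j := ?P)) i) R (quot_module R I)" if "i \<le> Suc j" for i
      using that N(1) submodule_principal_quot_module[OF I p] by (auto simp: le_Suc_eq)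
    show "(N(Suc j := ?P)) i \<subset> (N(Suc j := ?P)) (Suc i)" if "i < Suc j" for i
      using that N(2) psub by (cases "i = j") auto
  qed simp
qed

text \<open>
  One power above the length suffices: if it were not contained in \<open>I\<close>, multiplying it by
  \<open>p = 1\<close> would yield a chain of submodules that is too long.
\<close>

lemma (in local_ring) pow_subset_if_finite_length:
  assumes I: "ideal I R" and fin: "finite_length R (quot_module R I)"
  obtains k :: nat where "k \<ge> 1" "\<mm> [^]\<^bsub>ideals_set R\<^esub> k \<subseteq> I"
proof -
  obtain l where l: "module_length R (quot_module R I) = enat l"
    using fin unfolding finite_length_def by auto
  have "y \<in> I" if y: "y \<in> \<mm> [^]\<^bsub>ideals_set R\<^esub> (Suc l)" for y
  proof (rule ccontr)
    assume "y \<notin> I"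
    moreover have "y \<in> carrier R"
      using ideal.Icarr[OF ideal_ideals_set_pow[OF is_ideal] y] .
    ultimately have "enat (Suc l) \<le> module_length R (quot_module R I)"
      using chain_if_mult_pow_notin[OF I one_closed y]
      unfolding module_length_def by (intro Sup_upper) auto
    then show False using l by simp
  qed
  then have "\<mm> [^]\<^bsub>ideals_set R\<^esub> (Suc l) \<subseteq> I"
    by (rule subsetI)
  then show ?thesis
    by (rule that[rotated]) simp
qed

section \<open>Consequences of dimension one and depth zero\<close>

text \<open>
  A prime ideal contains all nilpotent elements, so \<open>\<mm>\<close> is the only one.
\<close>

lemma (in local_ring) krull_dim_0_if_max_nilpotent:
  assumes nil: "\<mm> [^]\<^bsub>ideals_set R\<^esub> (k::nat) = {\<zero>}"
  shows "krull_dim R = 0"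
proof -
  have prime_eq: "P = \<mm>" if P: "primeideal P R" for P
  proof -
    interpret P: primeideal P R by fact
    have "x \<in> P" if x: "x \<in> \<mm>" for x
    proof -
      have xc: "x \<in> carrier R" using x Icarr by blast
      have "x [^] j \<in> P \<Longrightarrow> x \<in> P" for j :: nat
      proof (induction j)
        case 0
        then show ?case using P.one_imp_carrier P.I_notcarr by simp
      next
        case (Suc j)
        then show ?case using P.I_prime[of "x [^] j" x] xc by auto
      qed
      moreover have "x [^] k = \<zero>"
        using pow_mem_ideals_set_pow[OF is_ideal x, of k] nil by simp
      ultimately show ?thesis
        using P.zero_closed by metis
    qed
    then show ?thesis
      using I_maximal[OF P.is_ideal] P.a_subset P.I_notcarr by blast
  qed
  have "n = 0" if "\<forall>i\<le>n. primeideal (P i) R" "\<forall>i<n. P i \<subset> P (Suc i)"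
    for n and P :: "nat \<Rightarrow> 'a set"
  proof (rule ccontr)
    assume "n \<noteq> 0"
    then have "P 0 \<subset> P (Suc 0)" "P 0 = \<mm>" "P (Suc 0) = \<mm>"
      using that prime_eq by auto
    then show False by simp
  qed
  then have "krull_dim R \<le> enat 0"
    unfolding krull_dim_def by (intro Sup_least) auto
  then show ?thesis by (simp add: zero_enat_def[symmetric])
qed

lemma (in local_ring) parameter_nonzero:
  assumes "parameter R \<mm> a" "krull_dim R = 1"
  shows "a \<noteq> \<zero>"
proof
  assume "a = \<zero>"
  moreover have "PIdl \<zero> = {\<zero>}"
    unfolding cgenideal_def by force
  ultimately have "finite_length R (quot_module R {\<zero>})"
    using assms(1) unfolding parameter_def by simp
  then obtain k :: nat where "\<mm> [^]\<^bsub>ideals_set R\<^esub> k \<subseteq> {\<zero>}"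
    using pow_subset_if_finite_length[OF zeroideal] by blast
  moreover have "\<zero> \<in> \<mm> [^]\<^bsub>ideals_set R\<^esub> k"
    using additive_subgroup.zero_closed[OF ideal.axioms(1)[OF ideal_ideals_set_pow[OF is_ideal]]] .
  ultimately have "krull_dim R = 0"
    using krull_dim_0_if_max_nilpotent by blast
  then show False using assms(2) by simp
qed

text \<open>
  A nonzerodivisor \<open>a \<in> \<mm>\<close> would be a regular sequence of length one.
\<close>

lemma (in local_ring) zero_divisor_if_depth_0:
  assumes depth: "depth R \<mm> = 0" and a: "a \<in> \<mm>"
  obtains y where "y \<in> carrier R" "a \<otimes> y = \<zero>" "y \<noteq> \<zero>"
proof -
  have ac: "a \<in> carrier R" using a Icarr by blast
  have "\<not> regular_seq R [a]"
  proof
    assume "regular_seq R [a]"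
    then have "enat (length [a]) \<le> depth R \<mm>"
      unfolding depth_def using a by (intro Sup_upper imageI) auto
    then show False using depth by (simp add: zero_enat_def)
  qed
  moreover have "Idl {a} \<noteq> carrier R"
    using genideal_minimal[OF is_ideal, of "{a}"] a I_notcarr a_subset by auto
  moreover have "Idl {} = {\<zero>}"
    using genideal_minimal[OF zeroideal, of "{}"] additive_subgroup.zero_closed[OF ideal.axioms(1)[OF genideal_ideal[of "{}"]]]
    by auto
  ultimately show ?thesis
    using that ac unfolding regular_seq_def by auto
qed

section \<open>Homomorphisms between two cyclic modules\<close>

text \<open>
  Throughout this locale, \<open>Hom\<^sub>R(R/I, R/J)\<close> is described through the ideal \<open>(J : I)\<close>
  of all representatives of possible images of \<open>1\<close>.
\<close>

locale quotient_hom = R?: cring R + I: ideal I R + J: ideal J R for I J and R (structure)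
begin

abbreviation Hom :: "('a set, 'a set \<Rightarrow> 'a set) module"
  where "Hom \<equiv> hom_quot_module R I (quot_module R J)"

definition colon :: "'a set"
  where "colon = {z \<in> carrier R. \<forall>i\<in>I. i \<otimes> z \<in> J}"

text \<open>
  Multiplication by \<open>z\<close> as a map \<open>R/I \<rightarrow> R/J\<close>. The choice of a representative does not matter when
  \<open>I z \<subseteq> J\<close>, that is, when \<open>z\<close> is in \<open>colon\<close>.
\<close>

definition mult_hom :: "'a \<Rightarrow> 'a set \<Rightarrow> 'a set"
  where "mult_hom z = (\<lambda>x\<in>carrier (R Quot I). J +> ((SOME r. r \<in> x) \<otimes> z))"

sublocale quotI: ring_hom_ring R "R Quot I" "(+>) I"
  by (rule I.rcos_ring_hom_ring)

sublocale quotJ: ring_hom_ring R "R Quot J" "(+>) J"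
  by (rule J.rcos_ring_hom_ring)

sublocale Hom: module "R Quot I" Hom
  by (intro module_hom_quot_module module_quot_module is_cring I.is_ideal J.is_ideal)

lemma Quot_cases:
  assumes "x \<in> carrier (R Quot K)"
  obtains r where "r \<in> carrier R" "x = K +> r"
  using assms that unfolding FactRing_simps by auto

lemma Hom_eqI:
  assumes "f \<in> carrier Hom" "g \<in> carrier Hom"
    and "\<And>r. r \<in> carrier R \<Longrightarrow> f (I +> r) = g (I +> r)"
  shows "f = g"
proof (rule extensionalityI)
  show "f \<in> extensional (carrier (R Quot I))" "g \<in> extensional (carrier (R Quot I))"
    using assms(1,2) by (auto simp: module_homs_def PiE_def)
  show "f x = g x" if "x \<in> carrier (R Quot I)" for x
    using that by (elim Quot_cases) (simp add: assms(3))
qed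

lemma mult_hom_coset:
  assumes z: "z \<in> colon" and r: "r \<in> carrier R"
  shows "mult_hom z (I +> r) = J +> (r \<otimes> z)"
proof -
  define s where "s = (SOME s. s \<in> I +> r)"
  have zc: "z \<in> carrier R"
    using z unfolding colon_def by blast
  have sin: "s \<in> I +> r"
    unfolding s_def by (rule someI) (rule I.a_rcos_self[OF r])
  then have s: "s \<in> carrier R"
    using I.a_subset r a_r_coset_subset_G by blast
  have "I +> s = I +> r"
    using a_repr_independence[OF sin r I.a_subgroup] by simp
  then have "s \<ominus> r \<in> I"
    using quotient_eq_iff_same_a_r_cos[OF I.is_ideal s r] by simp
  then have "(s \<ominus> r) \<otimes> z \<in> J"
    using z unfolding colon_def by blast
  moreover have "(s \<ominus> r) \<otimes> z = s \<otimes> z \<ominus> r \<otimes> z"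
    using s r zc by algebra
  ultimately have "J +> (s \<otimes> z) = J +> (r \<otimes> z)"
    using quotient_eq_iff_same_a_r_cos[OF J.is_ideal] s r zc by simp
  then show ?thesis
    using quotI.hom_closed[OF r] by (simp add: mult_hom_def s_def)
qed

lemma colon_carrier: "z \<in> colon \<Longrightarrow> z \<in> carrier R"
  unfolding colon_def by blast

lemma mult_hom_closed:
  assumes z: "z \<in> colon"
  shows "mult_hom z \<in> carrier Hom"
proof -
  note zc = colon_carrier[OF z]
  have "mult_hom z x \<in> carrier (R Quot J)" if "x \<in> carrier (R Quot I)" for x
    using that by (elim Quot_cases) (simp add: mult_hom_coset[OF z] zc del: quotJ.hom_mult)
  moreover have "mult_hom z \<in> extensional (carrier (R Quot I))"
    by (simp add: mult_hom_def)
  moreover have "mult_hom z (x \<oplus>\<^bsub>R Quot I\<^esub> y) = mult_hom z x \<oplus>\<^bsub>R Quot J\<^esub> mult_hom z y"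
    if xy: "x \<in> carrier (R Quot I)" "y \<in> carrier (R Quot I)" for x y
  proof -
    obtain r s where rs: "r \<in> carrier R" "x = I +> r" "s \<in> carrier R" "y = I +> s"
      using xy by (metis Quot_cases)
    have "mult_hom z (I +> (r \<oplus> s)) = J +> ((r \<oplus> s) \<otimes> z)"
      using rs by (intro mult_hom_coset z) simp
    also have "\<dots> = (J +> (r \<otimes> z)) \<oplus>\<^bsub>R Quot J\<^esub> (J +> (s \<otimes> z))"
      using rs zc by (simp add: l_distr del: quotJ.hom_mult)
    finally show ?thesis
      using rs by (simp add: mult_hom_coset[OF z] del: quotJ.hom_mult)
  qed
  moreover have "mult_hom z ((I +> r) \<otimes>\<^bsub>R Quot I\<^esub> x) = (J +> r) \<otimes>\<^bsub>R Quot J\<^esub> mult_hom z x"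
    if r: "r \<in> carrier R" and x: "x \<in> carrier (R Quot I)" for r x
  proof -
    obtain s where s: "s \<in> carrier R" "x = I +> s"
      using x by (rule Quot_cases)
    have "mult_hom z (I +> (r \<otimes> s)) = J +> ((r \<otimes> s) \<otimes> z)"
      using r s by (intro mult_hom_coset z) simp
    also have "\<dots> = (J +> r) \<otimes>\<^bsub>R Quot J\<^esub> (J +> (s \<otimes> z))"
      using r s zc by (simp add: m_assoc)
    finally show ?thesis
      using r s by (simp add: mult_hom_coset[OF z] del: quotJ.hom_mult)
  qed
  ultimately show ?thesis
    by (simp add: module_homs_def PiE_iff)
qed

lemma Hom_add_coset:
  "r \<in> carrier R \<Longrightarrow> (f \<oplus>\<^bsub>Hom\<^esub> g) (I +> r) = f (I +> r) \<oplus>\<^bsub>R Quot J\<^esub> g (I +> r)"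
  using quotI.hom_closed by simp

lemma ideal_colon: "ideal colon R"
proof (rule idealI)
  show "subgroup colon (add_monoid R)"
  proof (unfold_locales)
    show "inv\<^bsub>add_monoid R\<^esub> z \<in> colon" if "z \<in> colon" for z
    proof -
      have "i \<otimes> (\<ominus> z) \<in> J" if i: "i \<in> I" for i
        using \<open>z \<in> colon\<close> i I.Icarr[OF i] J.a_inv_closed unfolding colon_def by (simp add: r_minus)
      then show ?thesis
        using that unfolding colon_def by (simp add: a_inv_def[symmetric])
    qed
  qed (auto simp: colon_def r_distr I.Icarr)
next
  fix z x assume z: "z \<in> colon" and x: "x \<in> carrier R"
  have "i \<otimes> (x \<otimes> z) \<in> J" if i: "i \<in> I" for i
  proof -
    have "x \<otimes> (i \<otimes> z) \<in> J"
      using z x i J.I_l_closed unfolding colon_def by blast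
    then show ?thesis
      using z x I.Icarr[OF i] by (simp add: colon_def m_lcomm)
  qed
  then show "x \<otimes> z \<in> colon"
    using z x unfolding colon_def by simp
  then show "z \<otimes> x \<in> colon"
    using z x by (simp add: colon_def m_comm)
qed (rule ring_axioms)

lemma mult_hom_add:
  assumes "z \<in> colon" "w \<in> colon"
  shows "mult_hom (z \<oplus> w) = mult_hom z \<oplus>\<^bsub>Hom\<^esub> mult_hom w"
proof (rule Hom_eqI)
  interpret C: ideal colon R by (rule ideal_colon)
  have zw: "z \<oplus> w \<in> colon"
    using assms by (rule C.a_closed)
  then show "mult_hom (z \<oplus> w) \<in> carrier Hom"
    by (rule mult_hom_closed)
  show "mult_hom z \<oplus>\<^bsub>Hom\<^esub> mult_hom w \<in> carrier Hom"
    using assms by (intro Hom.add.m_closed mult_hom_closed)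
  show "mult_hom (z \<oplus> w) (I +> r) = (mult_hom z \<oplus>\<^bsub>Hom\<^esub> mult_hom w) (I +> r)"
    if r: "r \<in> carrier R" for r
    unfolding Hom_add_coset[OF r]
    using assms zw r colon_carrier by (simp add: mult_hom_coset r_distr del: quotJ.hom_mult)
qed

lemma mult_hom_smult:
  assumes z: "z \<in> colon" and r: "r \<in> carrier R"
  shows "mult_hom (r \<otimes> z) = (I +> r) \<odot>\<^bsub>Hom\<^esub> mult_hom z"
proof (rule Hom_eqI)
  interpret C: ideal colon R by (rule ideal_colon)
  have rz: "r \<otimes> z \<in> colon"
    using assms by (intro C.I_l_closed)
  then show "mult_hom (r \<otimes> z) \<in> carrier Hom"
    by (rule mult_hom_closed)
  show "(I +> r) \<odot>\<^bsub>Hom\<^esub> mult_hom z \<in> carrier Hom"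
    using assms quotI.hom_closed by (intro Hom.smult_closed mult_hom_closed)
  show "mult_hom (r \<otimes> z) (I +> s) = ((I +> r) \<odot>\<^bsub>Hom\<^esub> mult_hom z) (I +> s)"
    if s: "s \<in> carrier R" for s
  proof -
    have "((I +> r) \<odot>\<^bsub>Hom\<^esub> mult_hom z) (I +> s) = mult_hom z (I +> (r \<otimes> s))"
      using r s by simp
    also have "\<dots> = J +> ((r \<otimes> s) \<otimes> z)"
      using r s by (intro mult_hom_coset z) simp
    also have "\<dots> = J +> (s \<otimes> (r \<otimes> z))"
      using r s colon_carrier[OF z] by (simp add: m_ac del: quotJ.hom_mult)
    finally show ?thesis
      using rz s by (simp add: mult_hom_coset del: quotJ.hom_mult)
  qed
qed

lemma mult_hom_eq_iff:
  assumes "z \<in> colon" "w \<in> colon"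
  shows "mult_hom z = mult_hom w \<longleftrightarrow> z \<ominus> w \<in> J"
proof
  note zw = assms[THEN colon_carrier]
  note iff = quotient_eq_iff_same_a_r_cos[OF J.is_ideal]
  show "z \<ominus> w \<in> J" if "mult_hom z = mult_hom w"
  proof -
    have "J +> (\<one> \<otimes> z) = J +> (\<one> \<otimes> w)"
      using fun_cong[OF that, of "I +> \<one>"] mult_hom_coset[OF assms(1) one_closed]
        mult_hom_coset[OF assms(2) one_closed] by metis
    then show ?thesis
      using iff[OF zw] zw by (metis l_one)
  qed
  show "mult_hom z = mult_hom w" if d: "z \<ominus> w \<in> J"
  proof (rule Hom_eqI)
    fix r assume r: "r \<in> carrier R"
    have "J +> z = J +> w"
      using iff[OF zw] d by simp
    then have "J +> (r \<otimes> z) = J +> (r \<otimes> w)"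
      using r zw by simp
    then show "mult_hom z (I +> r) = mult_hom w (I +> r)"
      using assms r by (simp add: mult_hom_coset del: quotJ.hom_mult)
  qed (intro mult_hom_closed assms)+
qed

lemma zero_colon: "\<zero> \<in> colon"
  by (rule additive_subgroup.zero_closed[OF ideal.axioms(1)[OF ideal_colon]])

lemma mult_hom_zero: "mult_hom \<zero> = \<zero>\<^bsub>Hom\<^esub>"
proof -
  have "mult_hom \<zero> \<oplus>\<^bsub>Hom\<^esub> mult_hom \<zero> = mult_hom \<zero>"
    using mult_hom_add[OF zero_colon zero_colon] by simp
  then show ?thesis
    using mult_hom_closed[OF zero_colon] Hom.add.r_cancel_one by blast
qed

lemma mult_hom_eq_zero_iff:
  assumes "z \<in> colon"
  shows "mult_hom z = \<zero>\<^bsub>Hom\<^esub> \<longleftrightarrow> z \<in> J"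
proof -
  have "z \<ominus> \<zero> = z"
    using colon_carrier[OF assms] by (simp add: minus_eq)
  then show ?thesis
    using mult_hom_eq_iff[OF assms zero_colon] unfolding mult_hom_zero by metis
qed

text \<open>
  A homomorphism \<open>f\<close> is multiplication by any representative \<open>z\<close> of \<open>f(1)\<close>, and \<open>z\<close> is in
  \<open>(J : I)\<close> because \<open>f\<close> maps the class of each \<open>i \<in> I\<close>, which is zero, to the class of \<open>i z\<close>.
\<close>

lemma carrier_Hom: "carrier Hom = mult_hom ` colon"
proof
  show "mult_hom ` colon \<subseteq> carrier Hom"
    using mult_hom_closed by blast
  show "carrier Hom \<subseteq> mult_hom ` colon"
  proof
    fix f assume f: "f \<in> carrier Hom"
    have one: "I +> \<one> \<in> carrier (R Quot I)"
      by (rule quotI.hom_closed) simp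
    then have "f (I +> \<one>) \<in> carrier (R Quot J)"
      using f by (auto simp: module_homs_def simp del: quotI.hom_one)
    then obtain z where z: "z \<in> carrier R" "f (I +> \<one>) = J +> z"
      by (rule Quot_cases)
    have f_coset: "f (I +> r) = J +> (r \<otimes> z)" if r: "r \<in> carrier R" for r
    proof -
      have "f (I +> r) = f ((I +> r) \<otimes>\<^bsub>R Quot I\<^esub> (I +> \<one>))"
        using r by simp
      also have "\<dots> = (J +> r) \<otimes>\<^bsub>R Quot J\<^esub> f (I +> \<one>)"
        using f r one by (simp add: module_homs_def del: quotI.hom_one)
      finally show ?thesis
        using r z by simp
    qed
    have "i \<otimes> z \<in> J" if i: "i \<in> I" for i
    proof -
      note ic = I.Icarr[OF i]
      have "I +> i = I +> \<zero>"
        using quotient_eq_iff_same_a_r_cos[OF I.is_ideal ic zero_closed] i ic by (simp add: minus_eq)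
      then have "J +> (i \<otimes> z) = J +> (\<zero> \<otimes> z)"
        using f_coset[OF ic] f_coset[OF zero_closed] by simp
      then show ?thesis
        using quotient_eq_iff_same_a_r_cos[OF J.is_ideal, of "i \<otimes> z" "\<zero> \<otimes> z"] ic z(1) by (simp add: minus_eq)
    qed
    then have zC: "z \<in> colon"
      using z(1) unfolding colon_def by blast
    have "f = mult_hom z"
      using f zC by (intro Hom_eqI mult_hom_closed) (simp_all add: mult_hom_coset f_coset del: quotJ.hom_mult)
    then show "f \<in> mult_hom ` colon"
      using zC by blast
  qed
qed

lemma submodule_mult_hom_image:
  assumes K: "ideal K R" and KC: "K \<subseteq> colon"
  shows "submodule (mult_hom ` K) (R Quot I) Hom"
proof -
  interpret K: ideal K R by fact
  have smult: "s \<odot>\<^bsub>Hom\<^esub> f \<in> mult_hom ` K" if s: "s \<in> carrier (R Quot I)" and f: "f \<in> mult_hom ` K" for s f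
  proof -
    obtain r where r: "r \<in> carrier R" "s = I +> r"
      using s by (rule Quot_cases)
    obtain k where k: "k \<in> K" "f = mult_hom k"
      using f by blast
    have "s \<odot>\<^bsub>Hom\<^esub> f = mult_hom (r \<otimes> k)"
      unfolding r(2) k(2) by (rule mult_hom_smult[symmetric]) (use r k KC in auto)
    then show ?thesis
      using K.I_l_closed[OF k(1) r(1)] by (simp only: imageI)
  qed
  show ?thesis
  proof (rule Hom.submoduleI)
    show sub: "mult_hom ` K \<subseteq> carrier Hom"
      unfolding carrier_Hom using KC by blast
    show "\<zero>\<^bsub>Hom\<^esub> \<in> mult_hom ` K"
      using mult_hom_zero K.zero_closed by (metis imageI)
    show "\<ominus>\<^bsub>Hom\<^esub> f \<in> mult_hom ` K" if f: "f \<in> mult_hom ` K" for f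
    proof -
      have fc: "f \<in> carrier Hom"
        using f sub by blast
      have one: "\<one>\<^bsub>R Quot I\<^esub> \<in> carrier (R Quot I)"
        by (rule quotI.S.one_closed)
      have "\<ominus>\<^bsub>Hom\<^esub> f = (\<ominus>\<^bsub>R Quot I\<^esub> \<one>\<^bsub>R Quot I\<^esub>) \<odot>\<^bsub>Hom\<^esub> f"
        unfolding Hom.smult_l_minus[OF one fc] Hom.smult_one[OF fc] ..
      then show ?thesis
        using smult[OF quotI.S.a_inv_closed[OF one] f] by (simp only:)
    qed
    show "f \<oplus>\<^bsub>Hom\<^esub> g \<in> mult_hom ` K" if fg: "f \<in> mult_hom ` K" "g \<in> mult_hom ` K" for f g
    proof -
      obtain k l where k: "k \<in> K" "f = mult_hom k" and l: "l \<in> K" "g = mult_hom l"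
        using fg by blast
      have "f \<oplus>\<^bsub>Hom\<^esub> g = mult_hom (k \<oplus> l)"
        unfolding k(2) l(2) by (rule mult_hom_add[symmetric]) (use k l KC in auto)
      then show ?thesis
        using K.a_closed[OF k(1) l(1)] by (simp only: imageI)
    qed
  qed (rule smult)
qed

text \<open>
  The images are direct summands if \<open>K \<inter> (L + J) \<subseteq> J\<close>; as \<open>J \<subseteq> L\<close>, this is \<open>K \<inter> L \<subseteq> J\<close>.
\<close>

lemma direct_sum_mult_hom_images:
  assumes K: "ideal K R" and L: "ideal L R"
    and sum: "K <+>\<^bsub>R\<^esub> L = colon" and JL: "J \<subseteq> L" and KL: "K \<inter> L \<subseteq> J"
  shows "direct_sum_of (R Quot I) Hom (mult_hom ` K) (mult_hom ` L)"
proof -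
  interpret K: ideal K R by fact
  interpret L: ideal L R by fact
  have "k \<oplus> \<zero> \<in> K <+>\<^bsub>R\<^esub> L" if "k \<in> K" for k
    using that L.zero_closed unfolding set_add_def' by blast
  then have KC: "K \<subseteq> colon"
    unfolding sum using K.Icarr by auto
  have "\<zero> \<oplus> l \<in> K <+>\<^bsub>R\<^esub> L" if "l \<in> L" for l
    using that K.zero_closed unfolding set_add_def' by blast
  then have LC: "L \<subseteq> colon"
    unfolding sum using L.Icarr by auto
  have "f = \<zero>\<^bsub>Hom\<^esub>" if f: "f \<in> mult_hom ` K" "f \<in> mult_hom ` L" for f
  proof -
    obtain k l where kl: "k \<in> K" "l \<in> L" "f = mult_hom k" "mult_hom k = mult_hom l"
      using f by fastforce
    then have "k \<ominus> l \<in> L"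
      using mult_hom_eq_iff KC LC JL by blast
    then have "(k \<ominus> l) \<oplus> l \<in> L"
      using kl by (intro L.a_closed)
    moreover have "(k \<ominus> l) \<oplus> l = k"
      using kl K.Icarr L.Icarr by algebra
    ultimately have "k \<in> J"
      using kl KL by auto
    then show ?thesis
      using kl KC mult_hom_eq_zero_iff by blast
  qed
  moreover have "\<zero>\<^bsub>Hom\<^esub> \<in> mult_hom ` K \<inter> mult_hom ` L"
    using mult_hom_zero K.zero_closed L.zero_closed by (metis IntI imageI)
  moreover have "mult_hom ` K <+>\<^bsub>Hom\<^esub> mult_hom ` L = carrier Hom"
  proof -
    have "mult_hom ` K <+>\<^bsub>Hom\<^esub> mult_hom ` L =
        {mult_hom k \<oplus>\<^bsub>Hom\<^esub> mult_hom l | k l. k \<in> K \<and> l \<in> L}"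
      unfolding set_add_def' by blast
    also have "\<dots> = {mult_hom (k \<oplus> l) | k l. k \<in> K \<and> l \<in> L}"
      using mult_hom_add KC LC by (metis (no_types, lifting) subsetD)
    also have "\<dots> = mult_hom ` (K <+>\<^bsub>R\<^esub> L)"
      unfolding set_add_def' by blast
    finally show ?thesis
      unfolding sum carrier_Hom .
  qed
  ultimately show ?thesis
    unfolding direct_sum_of_def
    using submodule_mult_hom_image[OF K KC] submodule_mult_hom_image[OF L LC] by blast
qed

end

definition annihilator :: "('a, 'c) ring_scheme \<Rightarrow> 'a \<Rightarrow> 'a set"
  where "annihilator R a = {x \<in> carrier R. a \<otimes>\<^bsub>R\<^esub> x = \<zero>\<^bsub>R\<^esub>}"

lemma (in cring) ideal_annihilator:
  assumes a: "a \<in> carrier R"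
  shows "ideal (annihilator R a) R"
proof (rule idealI[OF ring_axioms])
  show "subgroup (annihilator R a) (add_monoid R)"
    using a by unfold_locales (auto simp: annihilator_def r_distr r_minus a_inv_def[symmetric])
  fix x r assume x: "x \<in> annihilator R a" and r: "r \<in> carrier R"
  have xc: "x \<in> carrier R" and ax: "a \<otimes> x = \<zero>"
    using x unfolding annihilator_def by auto
  have "a \<otimes> (x \<otimes> r) = a \<otimes> x \<otimes> r"
    by (rule m_assoc[OF a xc r, symmetric])
  then show "x \<otimes> r \<in> annihilator R a"
    using xc r unfolding ax annihilator_def by simp
  then show "r \<otimes> x \<in> annihilator R a"
    unfolding m_comm[OF xc r] .
qed

text \<open>
  If \<open>a z = r c a\<close>, then \<open>z - r c\<close> annihilates \<open>a\<close>.
\<close>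

lemma (in quotient_hom) colon_principal:
  assumes a: "a \<in> carrier R" and c: "c \<in> carrier R"
    and I: "I = PIdl a" and J: "J = PIdl (c \<otimes> a)"
  shows "annihilator R a <+>\<^bsub>R\<^esub> PIdl c = colon"
proof
  show "annihilator R a <+>\<^bsub>R\<^esub> PIdl c \<subseteq> colon"
  proof
    fix z assume "z \<in> annihilator R a <+>\<^bsub>R\<^esub> PIdl c"
    then obtain x r where x: "x \<in> carrier R" "a \<otimes> x = \<zero>" and r: "r \<in> carrier R"
      and z: "z = x \<oplus> r \<otimes> c"
      unfolding set_add_def' annihilator_def cgenideal_def by blast
    have "i \<otimes> z \<in> J" if i: "i \<in> I" for i
    proof -
      obtain s where s: "s \<in> carrier R" "i = s \<otimes> a"
        using i unfolding I cgenideal_def by blast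
      have "i \<otimes> z = s \<otimes> (a \<otimes> x) \<oplus> (s \<otimes> r) \<otimes> (c \<otimes> a)"
        unfolding s(2) z using s(1) x(1) r a c by algebra
      also have "\<dots> = (s \<otimes> r) \<otimes> (c \<otimes> a)"
        unfolding x(2) using s(1) r a c by simp
      finally show ?thesis
        unfolding J cgenideal_def using s(1) r by blast
    qed
    moreover have "z \<in> carrier R"
      using x(1) r c z by simp
    ultimately show "z \<in> colon"
      unfolding colon_def by blast
  qed
  show "colon \<subseteq> annihilator R a <+>\<^bsub>R\<^esub> PIdl c"
  proof
    fix z assume zC: "z \<in> colon"
    then have z: "z \<in> carrier R"
      by (rule colon_carrier)
    have "a \<in> I"
      unfolding I by (rule cgenideal_self[OF a])
    then have "a \<otimes> z \<in> J"
      using zC unfolding colon_def by blast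
    then obtain r where r: "r \<in> carrier R" "a \<otimes> z = r \<otimes> (c \<otimes> a)"
      unfolding J cgenideal_def by blast
    let ?x = "z \<ominus> r \<otimes> c"
    have "a \<otimes> ?x = a \<otimes> z \<ominus> r \<otimes> (c \<otimes> a)"
      using a c z r(1) by algebra
    also have "\<dots> = \<zero>"
      unfolding r(2) using a c r(1) by algebra
    finally have "?x \<in> annihilator R a"
      using z r(1) c unfolding annihilator_def by simp
    moreover have "r \<otimes> c \<in> PIdl c"
      unfolding cgenideal_def using r(1) by blast
    moreover have "z = ?x \<oplus> r \<otimes> c"
      using z r(1) c by algebra
    ultimately show "z \<in> annihilator R a <+>\<^bsub>R\<^esub> PIdl c"
      unfolding set_add_def' by blast
  qed
qed

section \<open>The annihilator of a parameter\<close>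

text \<open>
  What \<open>a\<close> kills is killed by every power of \<open>\<mm>\<close> that is contained in \<open>(a)\<close>.
\<close>

lemma (in local_ring) annihilator_subset_torsion_ideal:
  assumes a: "parameter R \<mm> a"
  shows "annihilator R a \<subseteq> torsion_ideal R \<mm>"
proof
  fix x assume x: "x \<in> annihilator R a"
  have ac: "a \<in> carrier R"
    using a Icarr unfolding parameter_def by blast
  obtain k :: nat where k: "k \<ge> 1" "\<mm> [^]\<^bsub>ideals_set R\<^esub> k \<subseteq> PIdl a"
    using pow_subset_if_finite_length[OF cgenideal_ideal[OF ac]] a unfolding parameter_def by blast
  have "y \<otimes> x = \<zero>" if y: "y \<in> \<mm> [^]\<^bsub>ideals_set R\<^esub> k" for y
  proof -
    obtain s where "s \<in> carrier R" "y = s \<otimes> a"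
      using y k(2) unfolding cgenideal_def by blast
    then show ?thesis
      using x ac unfolding annihilator_def by (simp add: m_assoc)
  qed
  then show "x \<in> torsion_ideal R \<mm>"
    using x k(1) unfolding torsion_ideal_def annihilator_def by blast
qed

text \<open>
  Suppose that only elements of \<open>(a)\<close> annihilate \<open>g\<close>. As \<open>a g = 0 \<noteq> a\<close>, \<open>g\<close> is not a unit, and so
  \<open>g\<^sup>k \<in> (a)\<close>. From \<open>g\<^sup>j\<^sup>+\<^sup>1 \<in> (a)\<close> one gets \<open>g\<^sup>j\<^sup>+\<^sup>1 = 0\<close>, since this element is a multiple of \<open>g\<close> and
  annihilated by \<open>a\<close> as well; thus \<open>g\<^sup>j\<close> annihilates \<open>g\<close> and \<open>g\<^sup>j \<in> (a)\<close>. This descent ends at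
  \<open>1 \<in> (a) \<subseteq> \<mm>\<close>.
\<close>

lemma (in local_ring) annihilator_elem_not_faithful:
  assumes a: "a \<in> \<mm>" "a \<noteq> \<zero>"
    and k: "\<mm> [^]\<^bsub>ideals_set R\<^esub> (k::nat) \<subseteq> PIdl a"
    and disj: "annihilator R a \<inter> PIdl a \<subseteq> {\<zero>}"
    and g: "g \<in> annihilator R a"
  obtains r where "r \<in> carrier R" "r \<otimes> g = \<zero>" "r \<notin> PIdl a"
proof -
  have ac: "a \<in> carrier R"
    using a(1) Icarr by blast
  have gc: "g \<in> carrier R" and ag: "a \<otimes> g = \<zero>"
    using g unfolding annihilator_def by auto
  have "g \<in> \<mm>"
  proof (rule ccontr)
    assume "g \<notin> \<mm>"
    then have "g \<in> Units R"
      using Units_if_notin_max[OF gc] by blast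
    then have "a = a \<otimes> g \<otimes> inv g"
      using ac gc by (simp add: m_assoc)
    then show False
      using a(2) ag \<open>g \<in> Units R\<close> by simp
  qed
  then have gk: "g [^] k \<in> PIdl a"
    using pow_mem_ideals_set_pow[OF is_ideal] k by blast
  have "\<exists>r. r \<in> carrier R \<and> r \<otimes> g = \<zero> \<and> r \<notin> PIdl a"
  proof (rule ccontr)
    assume "\<not> ?thesis"
    then have faithful: "r \<in> PIdl a" if "r \<in> carrier R" "r \<otimes> g = \<zero>" for r
      using that by blast
    have "g [^] j \<in> PIdl a \<Longrightarrow> \<one> \<in> PIdl a" for j :: nat
    proof (induction j)
      case (Suc j)
      have "g [^] Suc j \<in> annihilator R a"
        using ideal.I_l_closed[OF ideal_annihilator[OF ac] g, of "g [^] j"] gc by simp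
      then have "g [^] j \<otimes> g = \<zero>"
        using Suc.prems disj by auto
      then show ?case
        using Suc.IH faithful gc by simp
    qed simp
    then have "\<one> \<in> PIdl a"
      using gk .
    then have "\<one> \<in> \<mm>"
      using cgenideal_minimal[OF is_ideal a(1)] by blast
    then show False
      using one_imp_carrier I_notcarr by simp
  qed
  then show ?thesis
    using that by blast
qed

section \<open>A summand that is not free\<close>

text \<open>
  Any single basis vector is linearly independent.
\<close>

lemma free_module_faithful_vector:
  assumes "module A M" "free_module A M" "carrier M \<noteq> {\<zero>\<^bsub>M\<^esub>}"
  obtains v where "v \<in> carrier M" "\<And>s. s \<in> carrier A \<Longrightarrow> s \<odot>\<^bsub>M\<^esub> v = \<zero>\<^bsub>M\<^esub> \<Longrightarrow> s = \<zero>\<^bsub>A\<^esub>"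
proof -
  interpret module A M by fact
  obtain B where B: "is_basis A M B"
    using assms(2) unfolding free_module_def by blast
  have "B \<noteq> {}"
  proof
    assume "B = {}"
    then have "x = \<zero>\<^bsub>M\<^esub>" if "x \<in> carrier M" for x
      using B that unfolding is_basis_def by fastforce
    then show False using assms(3) by auto
  qed
  then obtain v where v: "v \<in> B" by blast
  then have vc: "v \<in> carrier M" using B unfolding is_basis_def by blast
  have "s = \<zero>\<^bsub>A\<^esub>" if s: "s \<in> carrier A" "s \<odot>\<^bsub>M\<^esub> v = \<zero>\<^bsub>M\<^esub>" for s
  proof -
    have "(\<Oplus>\<^bsub>M\<^esub>w\<in>{v}. s \<odot>\<^bsub>M\<^esub> w) = \<zero>\<^bsub>M\<^esub>"
      using s vc by (subst M.finsum_insert) auto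
    moreover have "\<forall>A' c. finite A' \<longrightarrow> A' \<subseteq> B \<longrightarrow> c \<in> A' \<rightarrow> carrier A \<longrightarrow>
        (\<Oplus>\<^bsub>M\<^esub>w\<in>A'. c w \<odot>\<^bsub>M\<^esub> w) = \<zero>\<^bsub>M\<^esub> \<longrightarrow> (\<forall>w\<in>A'. c w = \<zero>\<^bsub>A\<^esub>)"
      using B unfolding is_basis_def by blast
    ultimately show ?thesis
      using v s(1) by (elim allE[of _ "{v}"] allE[of _ "\<lambda>_. s"]) simp
  qed
  then show ?thesis using that vc by blast
qed

text \<open>
  The hypotheses say that the submodule is nonzero and that each of its elements is annihilated by a
  nonzero element of \<open>R/I\<close>, so that none of them can be a basis vector.
\<close>

lemma (in quotient_hom) not_free_mult_hom_image:
  assumes K: "ideal K R" "K \<subseteq> colon" and ne: "\<not> K \<subseteq> J"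
    and unfaithful: "\<And>g. g \<in> K \<Longrightarrow> \<exists>r\<in>carrier R. r \<otimes> g = \<zero> \<and> r \<notin> I"
  shows "\<not> free_module (R Quot I) (Hom\<lparr>carrier := mult_hom ` K\<rparr>)"
proof
  assume free: "free_module (R Quot I) (Hom\<lparr>carrier := mult_hom ` K\<rparr>)"
  obtain k where "k \<in> K" "k \<notin> J"
    using ne by blast
  then have "mult_hom k \<noteq> \<zero>\<^bsub>Hom\<^esub>" "mult_hom k \<in> mult_hom ` K"
    using K(2) mult_hom_eq_zero_iff by blast+
  then have "carrier (Hom\<lparr>carrier := mult_hom ` K\<rparr>) \<noteq> {\<zero>\<^bsub>Hom\<lparr>carrier := mult_hom ` K\<rparr>\<^esub>}"
    by auto
  then obtain v where v: "v \<in> mult_hom ` K"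
    "\<And>s. s \<in> carrier (R Quot I) \<Longrightarrow> s \<odot>\<^bsub>Hom\<^esub> v = \<zero>\<^bsub>Hom\<^esub> \<Longrightarrow> s = \<zero>\<^bsub>R Quot I\<^esub>"
    using free_module_faithful_vector[OF submodule.submodule_is_module
        [OF submodule_mult_hom_image[OF K] Hom.module_axioms] free]
    by auto
  obtain g where g: "g \<in> K" "v = mult_hom g"
    using v(1) by blast
  obtain r where r: "r \<in> carrier R" "r \<otimes> g = \<zero>" "r \<notin> I"
    using unfaithful[OF g(1)] by blast
  have "(I +> r) \<odot>\<^bsub>Hom\<^esub> v = mult_hom (r \<otimes> g)"
    unfolding g(2) using K(2) g(1) by (intro mult_hom_smult[symmetric] r(1)) blast
  then have "(I +> r) \<odot>\<^bsub>Hom\<^esub> v = \<zero>\<^bsub>Hom\<^esub>"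
    unfolding r(2) mult_hom_zero .
  then have "I +> r = \<zero>\<^bsub>R Quot I\<^esub>"
    by (rule v(2)[OF quotI.hom_closed[OF r(1)]])
  then have "I +> r = I"
    by (simp only: FactRing_def ring.simps)
  then show False
    using I.rcos_const_imp_mem[OF r(1)] r(3) by blast
qed

section \<open>Decomposing the module of homomorphisms\<close>

theorem theorem3p3:
  fixes R :: "('a, 'c) ring_scheme" (structure) and \<mm> :: "'a set" and n :: nat and a b :: 'a
  assumes "local_ring \<mm> R" and "noetherian_ring R"
    and "krull_dim R = 1" and "depth R \<mm> = 0"
    and "\<mm> [^]\<^bsub>ideals_set R\<^esub> n \<inter> torsion_ideal R \<mm> = {\<zero>}"
    and "parameter R \<mm> a" and "a \<in> \<mm> [^]\<^bsub>ideals_set R\<^esub> n"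
    and "parameter R \<mm> b" and "b \<in> PIdl (a [^] (2::nat))"
  shows "decomposable (R Quot PIdl a)
        (hom_quot_module R (PIdl a) (quot_module R (PIdl b))) \<and>
      (\<exists>N. direct_summand (R Quot PIdl a)
          (hom_quot_module R (PIdl a) (quot_module R (PIdl b))) N \<and>
        \<not> free_module (R Quot PIdl a)
          ((hom_quot_module R (PIdl a) (quot_module R (PIdl b)))\<lparr>carrier := N\<rparr>))"
proof -
  interpret local_ring \<mm> R by fact
  have am: "a \<in> \<mm>" and bm: "b \<in> \<mm>"
    using assms(6,8) unfolding parameter_def by auto
  then have a: "a \<in> carrier R" and b: "b \<in> carrier R"
    using Icarr by auto
  obtain r where r: "r \<in> carrier R" "b = r \<otimes> a [^] (2::nat)"
    using assms(9) unfolding cgenideal_def by blast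
  \<comment> \<open>One of the two factors \<open>a\<close> of \<open>b\<close> goes into \<open>c\<close>, which puts \<open>(c)\<close> inside \<open>(a)\<close>, away from the
    annihilator of \<open>a\<close>.\<close>
  define c where "c = r \<otimes> a"
  have c: "c \<in> carrier R" and b_eq: "b = c \<otimes> a"
    using r a by (simp_all add: c_def numeral_2_eq_2 m_assoc)
  interpret quotient_hom "PIdl a" "PIdl b" R
    by (intro quotient_hom.intro is_cring cgenideal_ideal a b)
  let ?Z = "annihilator R a"
  have Z: "ideal ?Z R"
    by (rule ideal_annihilator[OF a])
  have cL: "ideal (PIdl c) R"
    by (rule cgenideal_ideal[OF c])
  have "c \<in> PIdl a"
    unfolding c_def cgenideal_def using r(1) by blast
  then have ca: "PIdl c \<subseteq> PIdl a"
    by (rule cgenideal_minimal[OF cgenideal_ideal[OF a]])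
  have "b \<in> PIdl c"
    unfolding b_eq m_comm[OF c a] cgenideal_def using a by blast
  then have bc: "PIdl b \<subseteq> PIdl c"
    by (rule cgenideal_minimal[OF cL])
  have "PIdl a \<subseteq> \<mm> [^]\<^bsub>ideals_set R\<^esub> n"
    using assms(7) by (intro cgenideal_minimal ideal_ideals_set_pow is_ideal)
  then have disj: "?Z \<inter> PIdl a \<subseteq> {\<zero>}"
    using annihilator_subset_torsion_ideal[OF assms(6)] assms(5) by blast
  obtain k :: nat where k: "\<mm> [^]\<^bsub>ideals_set R\<^esub> k \<subseteq> PIdl a"
    using pow_subset_if_finite_length[OF cgenideal_ideal[OF a]] assms(6) unfolding parameter_def by blast
  have colon_eq: "?Z <+>\<^bsub>R\<^esub> PIdl c = colon"
    using a c b_eq by (intro colon_principal) simp_all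
  have sum: "direct_sum_of (R Quot PIdl a) Hom (mult_hom ` ?Z) (mult_hom ` (PIdl c))"
  proof (rule direct_sum_mult_hom_images[OF Z cL colon_eq bc])
    have "\<zero> \<in> PIdl b"
      by (rule J.zero_closed)
    then show "?Z \<inter> PIdl c \<subseteq> PIdl b"
      using disj ca by blast
  qed
  have colon_sum: "x \<oplus> y \<in> colon" if "x \<in> ?Z" "y \<in> PIdl c" for x y
    using that unfolding colon_eq[symmetric] set_add_def' by blast
  have ZC: "?Z \<subseteq> colon"
    using colon_sum[OF _ additive_subgroup.zero_closed[OF ideal.axioms(1)[OF cL]]]
      ideal.Icarr[OF Z] by force
  have "\<zero> \<oplus> c \<in> colon"
    using additive_subgroup.zero_closed[OF ideal.axioms(1)[OF Z]] cgenideal_self[OF c]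
    by (rule colon_sum)
  then have cC: "c \<in> colon"
    using c by simp
  have a0: "a \<noteq> \<zero>" and b0: "b \<noteq> \<zero>"
    using parameter_nonzero assms(3,6,8) by blast+
  obtain y where y: "y \<in> ?Z" "y \<noteq> \<zero>"
    using zero_divisor_if_depth_0[OF assms(4) am] unfolding annihilator_def by blast
  then have yJ: "y \<notin> PIdl b"
    using disj ca bc by blast
  have cJ: "c \<notin> PIdl b"
  proof
    assume "c \<in> PIdl b"
    then obtain s where s: "s \<in> carrier R" "c = s \<otimes> (c \<otimes> a)"
      unfolding b_eq cgenideal_def by blast
    then have "c \<ominus> s \<otimes> (c \<otimes> a) \<in> {\<zero>}"
      using c a by (metis m_closed minus_eq r_neg singletonI)
    then have "c = \<zero>"
      using mem_ideal_if_mult_max_diff[OF zeroideal c am s(1)] by blast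
    then show False
      using b0 b_eq a by simp
  qed
  have "mult_hom y \<noteq> \<zero>\<^bsub>Hom\<^esub>" "mult_hom c \<noteq> \<zero>\<^bsub>Hom\<^esub>"
    using mult_hom_eq_zero_iff yJ cJ y(1) ZC cC by blast+
  then have "mult_hom ` ?Z \<noteq> {\<zero>\<^bsub>Hom\<^esub>}" "mult_hom ` (PIdl c) \<noteq> {\<zero>\<^bsub>Hom\<^esub>}"
    using y(1) cgenideal_self[OF c] by blast+
  then have "decomposable (R Quot PIdl a) Hom"
    unfolding decomposable_def using sum by blast
  moreover have "direct_summand (R Quot PIdl a) Hom (mult_hom ` ?Z)"
    unfolding direct_summand_def using sum by blast
  moreover have "\<not> free_module (R Quot PIdl a) (Hom\<lparr>carrier := mult_hom ` ?Z\<rparr>)"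
  proof (rule not_free_mult_hom_image[OF Z ZC])
    show "\<not> ?Z \<subseteq> PIdl b"
      using y(1) yJ by blast
    show "\<exists>r\<in>carrier R. r \<otimes> g = \<zero> \<and> r \<notin> PIdl a" if "g \<in> ?Z" for g
      using annihilator_elem_not_faithful[OF am a0 k disj that] by blast
  qed
  ultimately show ?thesis
    by blast
qed

end
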